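(* For a first degree equation (projective connection) $$E u''=Du'^3+Cu'^2+Bu'+A,$$ with $A,B,C,D,E$ holomorphic functions of $(x,u)$, the locus of the centres of curvature of the $1$-parameter family of integral curves passing through a fixed point is a cubic curve of the type $$E(x_0^2+y_0^2)=-Dx_0^3+Cx_0^2y_0-Bx_0y_0^2+Ay_0^3,$$ where the coefficients are evaluated at the fixed point.
   Context: The plane is $\mathbb{C}^2$ with coordinates $(x,u)$. For a curve $u=u(x)$ through a fixed point $(x,u)$, with $v:=u'$ and $w:=u''\neq 0$ at that point, the centre of curvature (in coordinates relative to the point) is $$x_0=-\frac{v(1+v^2)}{w},\qquad y_0=\frac{1+v^2}{w}.$$ The fixed point is one at which $E\neq0$, so that a $1$-parameter family of integral curves (parametrized by $v$) passes through it. The locus is understood via its equation on the range of the centre map, i.e. for $w\neq0$, $1+v^2\neq0$, equivalently $y_0\neq0$, $x_0^2+y_0^2\neq0$. *)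

theory Defs
  imports "HOL-Complex_Analysis.Complex_Analysis"
begin

text \<open>
  Holomorphy in two variables on an open set: the Frechet derivative exists at every point and is
  complex linear. (The library's \<open>holomorphic_on\<close> covers one complex variable only.)
\<close>

definition holomorphic2_on :: "(complex \<times> complex \<Rightarrow> complex) \<Rightarrow> (complex \<times> complex) set \<Rightarrow> bool"
    (infixl "holomorphic2'_on" 50) where
  "f holomorphic2_on S \<longleftrightarrow>
     (\<forall>z\<in>S. \<exists>a b. (f has_derivative (\<lambda>(h, k). a * h + b * k)) (at z))"

text \<open>
  The function \<open>u\<close>, holomorphic on the open connected set \<open>U\<close>, is a solution on \<open>U\<close> of
  \<open>E u'' = D u'\<^sup>3 + C u'\<^sup>2 + B u' + A\<close>, where the coefficients live on \<open>\<Omega>\<close> and are evaluated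
  along the graph of \<open>u\<close>.
\<close>

definition integral_curve ::
  "(complex \<times> complex) set \<Rightarrow> (complex \<times> complex \<Rightarrow> complex) \<Rightarrow> (complex \<times> complex \<Rightarrow> complex) \<Rightarrow>
   (complex \<times> complex \<Rightarrow> complex) \<Rightarrow> (complex \<times> complex \<Rightarrow> complex) \<Rightarrow>
   (complex \<times> complex \<Rightarrow> complex) \<Rightarrow> complex set \<Rightarrow> (complex \<Rightarrow> complex) \<Rightarrow> bool" where
  "integral_curve \<Omega> A B C D E U u \<longleftrightarrow>
     open U \<and> connected U \<and> u holomorphic_on U \<and>
     (\<forall>x\<in>U. (x, u x) \<in> \<Omega> \<and>
        E (x, u x) * deriv (deriv u) x =
          D (x, u x) * deriv u x ^ 3 + C (x, u x) * deriv u x ^ 2 + B (x, u x) * deriv u x + A (x, u x))"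

text \<open>
  Coordinates relative to the point of the curve, for a curve with \<open>u' = v\<close> and \<open>u'' = w \<noteq> 0\<close>
  there.
\<close>

definition curvature_centre :: "complex \<Rightarrow> complex \<Rightarrow> complex \<times> complex" where
  "curvature_centre v w = (- (v * (1 + v\<^sup>2) / w), (1 + v\<^sup>2) / w)"

text \<open>
  Besides inflections (\<open>w = 0\<close>), where there is no centre of curvature, the isotropic slopes
  \<open>1 + v\<^sup>2 = 0\<close> are excluded: for them the centre degenerates to the point itself.
\<close>

definition curvature_centre_locus ::
  "(complex \<times> complex) set \<Rightarrow> (complex \<times> complex \<Rightarrow> complex) \<Rightarrow> (complex \<times> complex \<Rightarrow> complex) \<Rightarrow>
   (complex \<times> complex \<Rightarrow> complex) \<Rightarrow> (complex \<times> complex \<Rightarrow> complex) \<Rightarrow>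
   (complex \<times> complex \<Rightarrow> complex) \<Rightarrow> complex \<Rightarrow> complex \<Rightarrow> (complex \<times> complex) set" where
  "curvature_centre_locus \<Omega> A B C D E p q =
     {curvature_centre (deriv u p) (deriv (deriv u) p) | U u.
        integral_curve \<Omega> A B C D E U u \<and> p \<in> U \<and> u p = q \<and>
        deriv (deriv u) p \<noteq> 0 \<and> 1 + (deriv u p)\<^sup>2 \<noteq> 0}"

end

theory Submission
  imports Defs
begin

text \<open>
  Inverting the centre map gives \<open>v = - x0 / y0\<close> and \<open>w = (x0\<^sup>2 + y0\<^sup>2) / y0 ^ 3\<close>, and
  substitution turns the differential equation at the point into the cubic. That every point of the
  cubic is attained requires an integral curve with prescribed slope. Where \<open>E \<noteq> 0\<close>, the equation
  reads \<open>u'' = F x u u'\<close> with \<open>F\<close> holomorphic, hence Lipschitz in \<open>(u, u')\<close> by Cauchy's estimate,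
  and Picard iteration on a small disc yields a holomorphic solution.
\<close>

section \<open>Holomorphic functions of two variables along curves, and Lipschitz bounds\<close>

text \<open>Complex linearity of the derivative of \<open>f\<close> is what makes the chain rule
  give multiplication by the number \<open>a * deriv s t + b * deriv u t\<close>. Substitution along
  a curve thus reduces holomorphy in two variables to the one-variable theory.\<close>

lemma holomorphic2_on_compose:
  assumes f: "f holomorphic2_on \<Omega>" and S: "open S"
    and s: "s holomorphic_on S" and u: "u holomorphic_on S"
    and mem: "\<And>t. t \<in> S \<Longrightarrow> (s t, u t) \<in> \<Omega>"
  shows "(\<lambda>t. f (s t, u t)) holomorphic_on S"
proof -
  have "\<exists>d. ((\<lambda>t. f (s t, u t)) has_field_derivative d) (at t)" if t: "t \<in> S" for t
  proof -
    obtain a b where ab: "(f has_derivative (\<lambda>(h, k). a * h + b * k)) (at (s t, u t))"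
      using f mem[OF t] unfolding holomorphic2_on_def by blast
    have "(s has_derivative (*) (deriv s t)) (at t)" "(u has_derivative (*) (deriv u t)) (at t)"
      using holomorphic_derivI[OF s S t] holomorphic_derivI[OF u S t]
      by (simp_all add: has_field_derivative_def)
    then have "((\<lambda>t. (s t, u t)) has_derivative (\<lambda>h. (deriv s t * h, deriv u t * h))) (at t)"
      by (rule has_derivative_Pair)
    from has_derivative_compose[OF this ab]
    have "((\<lambda>t. f (s t, u t)) has_derivative (*) (a * deriv s t + b * deriv u t)) (at t)"
      by (rule has_derivative_eq_rhs) (simp add: fun_eq_iff algebra_simps)
    then show ?thesis
      unfolding has_field_derivative_def by blast
  qed
  then show ?thesis
    using S by (auto simp: holomorphic_on_open)
qed

lemma holomorphic2_on_imp_continuous_on: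
  assumes "f holomorphic2_on S"
  shows "continuous_on S f"
  using assms unfolding holomorphic2_on_def
  by (meson continuous_at_imp_continuous_on has_derivative_continuous)

text \<open>Around each point of the half disc a disc of radius \<open>R/4\<close> still fits into
  the full one, so Cauchy's estimate bounds the derivative by \<open>M / (R/4)\<close>. The half
  disc is convex, hence the mean value inequality applies.\<close>

lemma bounded_holomorphic_imp_lipschitz:
  fixes f :: "complex \<Rightarrow> complex"
  assumes hol: "f holomorphic_on ball q R" and R: "R > 0"
    and bound: "\<And>z. z \<in> ball q R \<Longrightarrow> norm (f z) \<le> M"
    and x: "x \<in> ball q (R/2)" and y: "y \<in> ball q (R/2)"
  shows "norm (f x - f y) \<le> 4 * M / R * norm (x - y)"
proof (rule field_differentiable_bound[OF convex_ball _ _ x y])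
  fix z assume z: "z \<in> ball q (R/2)"
  have sub: "cball z (R/4) \<subseteq> ball q R"
  proof
    fix t assume "t \<in> cball z (R/4)"
    with z have "dist q z < R/2" "dist z t \<le> R/4" by auto
    with dist_triangle[of q t z] R show "t \<in> ball q R" by simp
  qed
  have "z \<in> ball q R" using z R by auto
  then show "(f has_field_derivative deriv f z) (at z within ball q (R/2))"
    using holomorphic_derivI[OF hol open_ball] has_field_derivative_at_within by blast
  have "norm ((deriv ^^ 1) f z) \<le> fact 1 * M / (R/4) ^ 1"
  proof (rule Cauchy_inequality)
    show "f holomorphic_on ball z (R/4)"
      using hol sub by (meson ball_subset_cball holomorphic_on_subset order_trans)
    show "continuous_on (cball z (R/4)) f"
      using hol sub by (meson holomorphic_on_subset holomorphic_on_imp_continuous_on)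
    show "norm (f t) \<le> M" if "norm (z - t) = R/4" for t
      using that sub by (intro bound) (auto simp: dist_norm)
  qed (use R in auto)
  then show "norm (deriv f z) \<le> 4 * M / R" by (simp add: mult.commute)
qed

section \<open>Fixed points of contractions on bounded holomorphic functions\<close>

text \<open>Banach's fixed point argument. Distances occur only as pointwise bounds
  \<open>c\<close>, so no metric space of functions has to be formed; the limit stays in the class
  because locally uniform limits of holomorphic functions are holomorphic.\<close>

lemma holomorphic_contraction_fixpoint:
  fixes T :: "(complex \<Rightarrow> complex) \<Rightarrow> complex \<Rightarrow> complex"
  assumes S: "open S" and M: "0 \<le> M"
    and hol: "\<And>w. w holomorphic_on S \<Longrightarrow> (\<And>x. x \<in> S \<Longrightarrow> norm (w x) \<le> M) \<Longrightarrow> T w holomorphic_on S"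
    and bound: "\<And>w x. w holomorphic_on S \<Longrightarrow> (\<And>x. x \<in> S \<Longrightarrow> norm (w x) \<le> M) \<Longrightarrow> x \<in> S \<Longrightarrow>
      norm (T w x) \<le> M"
    and contr: "\<And>w w' c x. w holomorphic_on S \<Longrightarrow> (\<And>x. x \<in> S \<Longrightarrow> norm (w x) \<le> M) \<Longrightarrow>
      w' holomorphic_on S \<Longrightarrow> (\<And>x. x \<in> S \<Longrightarrow> norm (w' x) \<le> M) \<Longrightarrow>
      (\<And>x. x \<in> S \<Longrightarrow> norm (w x - w' x) \<le> c) \<Longrightarrow> x \<in> S \<Longrightarrow> norm (T w x - T w' x) \<le> c / 2"
  obtains w where "w holomorphic_on S" "\<And>x. x \<in> S \<Longrightarrow> norm (w x) \<le> M" "\<And>x. x \<in> S \<Longrightarrow> T w x = w x"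
proof -
  define W where "W n = (T ^^ n) (\<lambda>_. 0)" for n
  have W_Suc: "W (Suc n) = T (W n)" for n by (simp add: W_def)
  have W: "W n holomorphic_on S \<and> (\<forall>x\<in>S. norm (W n x) \<le> M)" for n
  proof (induction n)
    case 0
    then show ?case using M by (simp add: W_def)
  next
    case (Suc n)
    then show ?case unfolding W_Suc using hol bound by blast
  qed
  have step: "norm (W (Suc n) x - W n x) \<le> M * (1/2) ^ n" if "x \<in> S" for n x
    using that
  proof (induction n arbitrary: x)
    \<comment> \<open>The iteration starts at the zero function, so the first gap is
      \<open>W 1\<close> itself, bounded by \<open>M\<close>; every later gap is half the previous
      bound.\<close>
    case 0
    then show ?case using W[of 1] by (simp add: W_def)
  next
    case (Suc n)
    have "norm (T (W (Suc n)) x - T (W n) x) \<le> (M * (1/2) ^ n) / 2"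
      by (rule contr) (use W Suc in auto)
    then show ?case by (simp add: W_Suc)
  qed
  \<comment> \<open>The limit is written as a telescoping series, dominated by a geometric one.
    Since \<open>W 0\<close> is zero, its partial sums are exactly the iterates.\<close>
  define w where "w x = (\<Sum>n. W (Suc n) x - W n x)" for x
  have "uniform_limit S (\<lambda>n x. \<Sum>i<n. W (Suc i) x - W i x) w sequentially"
    unfolding w_def
    by (rule Weierstrass_m_test_ev[where M = "\<lambda>n. M * (1/2) ^ n"])
      (use step in \<open>auto intro!: always_eventually summable_mult summable_geometric\<close>)
  moreover have "(\<Sum>i<n. W (Suc i) x - W i x) = W n x" for n x
    using sum_lessThan_telescope[of "\<lambda>i. W i x" n] by (simp add: W_def[of 0])
  ultimately have lim: "uniform_limit S W w sequentially" by simp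
  have hol_w: "w holomorphic_on S"
  proof (rule holomorphic_uniform_sequence[OF S])
    show "W n holomorphic_on S" for n using W by blast
    show "\<exists>d>0. cball x d \<subseteq> S \<and> uniform_limit (cball x d) W w sequentially" if "x \<in> S" for x
      using S that lim by (meson open_contains_cball uniform_limit_on_subset)
  qed
  have pointwise: "(\<lambda>n. W n x) \<longlonglongrightarrow> w x" if "x \<in> S" for x
    using tendsto_uniform_limitI[OF lim that] .
  have bound_w: "norm (w x) \<le> M" if "x \<in> S" for x
    using W that by (intro Lim_norm_ubound[OF _ pointwise[OF that]]) auto
  have "T w x = w x" if x: "x \<in> S" for x
  \<comment> \<open>The shifted iterates tend to \<open>w x\<close>, and also to
    \<open>T w x\<close>: by the contraction bound, uniform closeness of \<open>W n\<close> to
    \<open>w\<close> passes to their images under \<open>T\<close>.\<close>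
  proof (rule LIMSEQ_unique)
    show "(\<lambda>n. W (Suc n) x) \<longlonglongrightarrow> w x" using pointwise[OF x] by (rule LIMSEQ_Suc)
    show "(\<lambda>n. W (Suc n) x) \<longlonglongrightarrow> T w x"
    proof (rule tendstoI)
      fix e :: real assume e: "0 < e"
      from lim e have "\<forall>\<^sub>F n in sequentially. \<forall>y\<in>S. dist (W n y) (w y) < e"
        by (auto simp: uniform_limit_iff)
      then show "\<forall>\<^sub>F n in sequentially. dist (W (Suc n) x) (T w x) < e"
      proof eventually_elim
        case (elim n)
        have "norm (T (W n) x - T w x) \<le> e / 2"
          by (rule contr) (use W hol_w bound_w x elim in \<open>auto simp: dist_norm less_imp_le\<close>)
        then show ?case using e by (simp add: W_Suc dist_norm)
      qed
    qed
  qed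
  with hol_w bound_w show thesis by (rule that)
qed

section \<open>Local existence for second order equations\<close>

lemma eventually_mult_less_at_right_0:
  fixes c d :: real
  assumes "0 < d"
  shows "\<forall>\<^sub>F r in at_right 0. c * r < d"
proof -
  have "((\<lambda>r. c * r) \<longlongrightarrow> c * 0) (at_right 0)" by (intro tendsto_intros)
  then show ?thesis using assms by (auto dest: order_tendstoD)
qed

text \<open>The assumption \<open>hol\<close> encodes holomorphy of \<open>F\<close> in three
  variables as stability under substitution. Constant substitutions in two places give the
  one-variable functions for the Lipschitz bound; general ones show that the Picard operator
  preserves holomorphy.\<close>

lemma holomorphic_ode2_exists:
  fixes F :: "complex \<Rightarrow> complex \<Rightarrow> complex \<Rightarrow> complex"
  assumes R: "0 < R"
    and bound: "\<And>x u v. x \<in> ball p R \<Longrightarrow> u \<in> ball q R \<Longrightarrow> v \<in> ball v0 R \<Longrightarrow> norm (F x u v) \<le> M"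
    and hol: "\<And>S x u v. open S \<Longrightarrow> x holomorphic_on S \<Longrightarrow> u holomorphic_on S \<Longrightarrow> v holomorphic_on S \<Longrightarrow>
      (\<And>t. t \<in> S \<Longrightarrow> x t \<in> ball p R \<and> u t \<in> ball q R \<and> v t \<in> ball v0 R) \<Longrightarrow>
      (\<lambda>t. F (x t) (u t) (v t)) holomorphic_on S"
  obtains r u where "0 < r" "r \<le> R" "u holomorphic_on ball p r" "u p = q" "deriv u p = v0"
    "\<And>x. x \<in> ball p r \<Longrightarrow> u x \<in> ball q R"
    "\<And>x. x \<in> ball p r \<Longrightarrow> deriv u x \<in> ball v0 R"
    "\<And>x. x \<in> ball p r \<Longrightarrow> deriv (deriv u) x = F x (u x) (deriv u x)"
proof -
  \<comment> \<open>This is the constant from Cauchy's estimate. Changing \<open>u\<close> and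
    \<open>v\<close> one after the other makes it serve both arguments on the half radii.\<close>
  define L where "L = 4 * M / R"
  have M: "0 \<le> M" using bound[of p q v0] R by (auto intro: order_trans[OF norm_ge_zero])
  have L: "0 \<le> L" using M R by (simp add: L_def)
  have lipschitz: "norm (F x u v - F x u' v') \<le> L * norm (u - u') + L * norm (v - v')"
    if x: "x \<in> ball p R" and u: "u \<in> ball q (R/2)" "u' \<in> ball q (R/2)"
      and v: "v \<in> ball v0 (R/2)" "v' \<in> ball v0 (R/2)" for x u u' v v'
  proof -
    have v': "v \<in> ball v0 R" and u'': "u' \<in> ball q R" using u v R by auto
    have "norm (F x u v - F x u' v) \<le> L * norm (u - u')"
      unfolding L_def
      by (rule bounded_holomorphic_imp_lipschitz[where f = "\<lambda>u. F x u v", OF hol R bound])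
        (use x u v' in auto)
    moreover have "norm (F x u' v - F x u' v') \<le> L * norm (v - v')"
      unfolding L_def
      by (rule bounded_holomorphic_imp_lipschitz[where f = "\<lambda>v. F x u' v", OF hol R bound])
        (use x v u'' in auto)
    ultimately show ?thesis
      using norm_triangle_ineq[of "F x u v - F x u' v" "F x u' v - F x u' v'"] by simp
  qed
  \<comment> \<open>In order: \<open>r < 1\<close> absorbs the second factor \<open>r\<close> from
    integrating twice, \<open>r < R\<close> keeps the disc in the domain, the next two keep
    \<open>u'\<close> within \<open>R/2\<close> of \<open>v0\<close> and \<open>u\<close> within
    \<open>R/2\<close> of \<open>q\<close> (using \<open>norm u' \<le> norm v0 + R/2\<close>), and
    the last yields the contraction factor 1/2.\<close>
  have "\<forall>\<^sub>F r in at_right 0. 0 < r \<and> 1 * r < 1 \<and> 1 * r < R \<and> M * r < R/2 \<and>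
      (norm v0 + R/2) * r < R/2 \<and> (4 * L) * r < 1"
    using R by (intro eventually_conj eventually_mult_less_at_right_0 eventually_at_right_less) auto
  then obtain r where r: "0 < r" "r < 1" "r < R" "M * r < R/2" "(norm v0 + R/2) * r < R/2"
      "(4 * L) * r < 1"
    by (auto dest: eventually_happens'[rotated])
  let ?B = "ball p r"
  have p: "p \<in> ?B" using r by simp
  \<comment> \<open>The implication stands under the existential so that choice gives a total
    operator \<open>P f c\<close>: the primitive of \<open>f\<close> with value \<open>c\<close> at
    \<open>p\<close>, arbitrary for other \<open>f\<close>.\<close>
  have "\<exists>g. f holomorphic_on ?B \<longrightarrow>
      g p = c \<and> (\<forall>x\<in>?B. (g has_field_derivative f x) (at x))" for f c
  proof (cases "f holomorphic_on ?B")
    case True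
    then obtain g where g: "\<And>x. x \<in> ?B \<Longrightarrow> (g has_field_derivative f x) (at x within ?B)"
      using holomorphic_convex_primitive'[OF convex_ball open_ball] by blast
    have "((\<lambda>x. g x - g p + c) has_field_derivative f x) (at x)" if "x \<in> ?B" for x
      using g[OF that] that at_within_open[OF that open_ball]
      by (auto intro!: derivative_eq_intros)
    then show ?thesis by (intro exI[of _ "\<lambda>x. g x - g p + c"]) auto
  qed auto
  then obtain P where P: "\<And>f c. f holomorphic_on ?B \<longrightarrow>
      P f c p = c \<and> (\<forall>x\<in>?B. (P f c has_field_derivative f x) (at x))"
    by metis
  have P_p: "P f c p = c" and P_deriv: "x \<in> ?B \<Longrightarrow> (P f c has_field_derivative f x) (at x)"
    if "f holomorphic_on ?B" for f c x
    using P that by blast+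
  have P_hol: "P f c holomorphic_on ?B" if "f holomorphic_on ?B" for f c
    unfolding holomorphic_on_open[OF open_ball] using P_deriv[OF that] by (intro ballI exI)
  \<comment> \<open>Both primitives equal \<open>c\<close> at \<open>p\<close>, so their difference
    vanishes there and the mean value inequality gains a factor \<open>r\<close>.\<close>
  have P_diff: "norm (P f c x - P g c x) \<le> b * r"
    if f: "f holomorphic_on ?B" and g: "g holomorphic_on ?B" and x: "x \<in> ?B"
      and b: "\<And>x. x \<in> ?B \<Longrightarrow> norm (f x - g x) \<le> b" for f g c b x
  proof -
    have "norm ((P f c x - P g c x) - (P f c p - P g c p)) \<le> b * norm (x - p)"
      by (rule field_differentiable_bound[where f = "\<lambda>x. P f c x - P g c x"
            and f' = "\<lambda>x. f x - g x" and S = ?B, OF convex_ball])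
        (use x p b DERIV_diff[OF P_deriv[OF f] P_deriv[OF g], THEN has_field_derivative_at_within] in blast)+
    also have "\<dots> \<le> b * r"
      using b[OF p] x norm_ge_zero[of "f p - g p"]
      by (intro mult_left_mono) (auto simp: dist_norm norm_minus_commute simp del: norm_ge_zero)
    finally show ?thesis using P_p[OF f] P_p[OF g] by simp
  qed
  have P_bound: "norm (P f c x - c) \<le> b * r"
    if f: "f holomorphic_on ?B" and x: "x \<in> ?B"
      and b: "\<And>x. x \<in> ?B \<Longrightarrow> norm (f x) \<le> b" for f c b x
  proof -
    have "norm (P f c x - P f c p) \<le> b * norm (x - p)"
      by (rule field_differentiable_bound[where f' = f and S = ?B, OF convex_ball])
        (use x p b P_deriv[OF f, THEN has_field_derivative_at_within] in blast)+
    also have "\<dots> \<le> b * r"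
      using b[OF p] x norm_ge_zero[of "f p"]
      by (intro mult_left_mono) (auto simp: dist_norm norm_minus_commute simp del: norm_ge_zero)
    finally show ?thesis using P_p[OF f] by simp
  qed
  \<comment> \<open>For a candidate second derivative \<open>w\<close>, \<open>V w\<close> is the
    slope and \<open>U w\<close> the curve. The initial values are built in, so only the
    differential equation remains to be solved.\<close>
  define V where "V w = P w v0" for w
  define U where "U w = P (V w) q" for w
  have V_hol: "V w holomorphic_on ?B" and U_hol: "U w holomorphic_on ?B"
    if "w holomorphic_on ?B" for w
    using that P_hol by (auto simp: V_def U_def)
  have V_mem: "V w x \<in> ball v0 (R/2)"
    if "w holomorphic_on ?B" "\<forall>x\<in>?B. norm (w x) \<le> M" "x \<in> ?B" for w x
    using P_bound[OF that(1,3) bspec[OF that(2)], of v0] r by (simp add: V_def dist_norm norm_minus_commute)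
  have U_mem: "U w x \<in> ball q (R/2)"
    if w: "w holomorphic_on ?B" "\<forall>x\<in>?B. norm (w x) \<le> M" "x \<in> ?B" for w x
  proof -
    have "norm (V w y) \<le> norm v0 + R/2" if "y \<in> ?B" for y
      using V_mem[OF w(1,2) that] norm_triangle_sub[of "V w y" v0]
      by (simp add: dist_norm norm_minus_commute)
    from P_bound[OF V_hol[OF w(1)] w(3) this, of q] r show ?thesis
      by (simp add: U_def dist_norm norm_minus_commute)
  qed
  have half: "ball z (R/2) \<subseteq> ball z R" for z :: complex using R by auto
  have sub: "?B \<subseteq> ball p R" using r by auto
  txt \<open>Iterating on the second derivative keeps the unknown scalar: \<open>u\<close> and \<open>u'\<close> are recovered from
    it as primitives.\<close>
  define T where "T w x = F x (U w x) (V w x)" for w x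
  obtain w where w: "w holomorphic_on ?B" and w_bound: "\<forall>x\<in>?B. norm (w x) \<le> M"
    and fix_w: "\<And>x. x \<in> ?B \<Longrightarrow> T w x = w x"
  proof (rule holomorphic_contraction_fixpoint[OF open_ball[of p r] M, of T])
    fix w assume w: "w holomorphic_on ?B" and "\<And>x. x \<in> ?B \<Longrightarrow> norm (w x) \<le> M"
    then have w_bound: "\<forall>x\<in>?B. norm (w x) \<le> M" by blast
    note mem = U_mem[OF w w_bound] V_mem[OF w w_bound]
    show "T w holomorphic_on ?B"
      unfolding T_def using mem half sub V_hol[OF w] U_hol[OF w]
      by (intro hol) (auto simp del: mem_ball)
    show "norm (T w x) \<le> M" if "x \<in> ?B" for x
      unfolding T_def using mem[OF that] half sub that
      by (intro bound) (auto simp del: mem_ball)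
    fix w' c x
    assume w': "w' holomorphic_on ?B" and "\<And>x. x \<in> ?B \<Longrightarrow> norm (w' x) \<le> M"
      and c: "\<And>x. x \<in> ?B \<Longrightarrow> norm (w x - w' x) \<le> c" and x: "x \<in> ?B"
    then have w'_bound: "\<forall>x\<in>?B. norm (w' x) \<le> M" by blast
    have "0 \<le> c" using c[OF p] by (rule order_trans[OF norm_ge_zero])
    have V_diff: "norm (V w y - V w' y) \<le> c * r" if "y \<in> ?B" for y
      unfolding V_def by (rule P_diff) (use w w' c that in auto)
    have "norm (U w x - U w' x) \<le> (c * r) * r"
      unfolding U_def by (rule P_diff) (use w w' V_hol V_diff x in auto)
    also have "\<dots> \<le> c * r"
      using r \<open>0 \<le> c\<close> by (intro mult_left_le) auto
    finally have U_diff: "norm (U w x - U w' x) \<le> c * r" .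
    have "norm (T w x - T w' x) \<le> L * norm (U w x - U w' x) + L * norm (V w x - V w' x)"
      unfolding T_def using sub x mem U_mem[OF w' w'_bound] V_mem[OF w' w'_bound]
      by (intro lipschitz) (auto simp del: mem_ball)
    also have "\<dots> \<le> L * (c * r) + L * (c * r)"
      using U_diff V_diff[OF x] L by (intro add_mono mult_left_mono)
    also have "\<dots> = c / 2 * ((4 * L) * r)" by simp
    also have "\<dots> \<le> c / 2"
      using r \<open>0 \<le> c\<close> by (intro mult_left_le) auto
    finally show "norm (T w x - T w' x) \<le> c / 2" .
  qed (use that in blast)
  have deriv_U: "deriv (U w) x = V w x" if "x \<in> ?B" for x
    unfolding U_def using P_deriv[OF V_hol[OF w] that] by (rule DERIV_imp_deriv)
  have deriv2_U: "deriv (deriv (U w)) x = w x" if "x \<in> ?B" for x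
  proof -
    \<comment> \<open>\<open>deriv (U w)\<close> and \<open>V w\<close> are known to agree only on
      the disc; as it is open, they agree near \<open>x\<close>, which suffices to transfer the
      derivative.\<close>
    have "(deriv (U w) has_field_derivative w x) (at x)"
      by (rule DERIV_cong_ev[OF refl _ refl, THEN iffD2, OF _ P_deriv[OF w that, of v0, folded V_def]])
        (use deriv_U that in \<open>auto intro!: eventually_nhds_in_open[OF open_ball, THEN eventually_mono]\<close>)
    then show ?thesis by (rule DERIV_imp_deriv)
  qed
  show thesis
  proof (rule that[of r "U w"])
    show "U w p = q" unfolding U_def by (rule P_p[OF V_hol[OF w]])
    show "deriv (U w) p = v0" using deriv_U[OF p] P_p[OF w] by (simp add: V_def)
    fix x assume x: "x \<in> ?B"
    show "U w x \<in> ball q R" using U_mem[OF w w_bound x] half by blast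
    show "deriv (U w) x \<in> ball v0 R" using V_mem[OF w w_bound x] half deriv_U[OF x] by (metis subsetD)
    show "deriv (deriv (U w)) x = F x (U w x) (deriv (U w) x)"
      using deriv2_U[OF x] deriv_U[OF x] fix_w[OF x] by (simp add: T_def)
  qed (use r U_hol[OF w] in auto)
qed

section \<open>Integral curves with prescribed slope\<close>

lemma integral_curve_exists:
  assumes \<Omega>: "open \<Omega>"
    and hol: "A holomorphic2_on \<Omega>" "B holomorphic2_on \<Omega>" "C holomorphic2_on \<Omega>"
      "D holomorphic2_on \<Omega>" "E holomorphic2_on \<Omega>"
    and pq: "(p, q) \<in> \<Omega>" "E (p, q) \<noteq> 0"
  obtains U u where "integral_curve \<Omega> A B C D E U u" "p \<in> U" "u p = q" "deriv u p = v0"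
proof -
  define F where "F x u v = (D (x, u) * v ^ 3 + C (x, u) * v\<^sup>2 + B (x, u) * v + A (x, u)) / E (x, u)"
    for x u v
  note cont = hol[THEN holomorphic2_on_imp_continuous_on]
  have "open (\<Omega> \<inter> E -` (- {0}))"
    using cont(5) \<Omega> by (rule continuous_open_preimage) auto
  moreover have "(p, q) \<in> \<Omega> \<inter> E -` (- {0})" using pq by simp
  ultimately obtain X Y where XY: "open X" "open Y" "(p, q) \<in> X \<times> Y" "X \<times> Y \<subseteq> \<Omega> \<inter> E -` (- {0})"
    by (rule open_prod_elim)
  obtain a where a: "0 < a" "cball p a \<subseteq> X" using XY by (auto simp: open_contains_cball)
  obtain b where b: "0 < b" "cball q b \<subseteq> Y" using XY by (auto simp: open_contains_cball)
  \<comment> \<open>One radius serves all variables. It may be used for the slope too, since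
    \<open>F\<close> is polynomial in \<open>v\<close> and so puts no restriction on
    \<open>v0\<close>.\<close>
  define R where "R = min a b"
  have R: "0 < R" using a b by (simp add: R_def)
  have mem: "(x, u) \<in> \<Omega> \<and> E (x, u) \<noteq> 0" if "x \<in> cball p R" "u \<in> cball q R" for x u
  proof -
    have "x \<in> X" "u \<in> Y" using that a b by (auto simp: R_def subset_iff)
    then show ?thesis using XY(4) by auto
  qed
  \<comment> \<open>Closed discs make the domain compact, so continuity of \<open>F\<close> alone
    supplies the bound \<open>M\<close>.\<close>
  let ?K = "cball p R \<times> cball q R \<times> cball v0 R"
  have "continuous_on ?K (\<lambda>(x, u, v). F x u v)"
    unfolding F_def split_beta
    by (intro continuous_intros; (intro continuous_on_compose2[OF cont(1)]
          continuous_on_compose2[OF cont(2)] continuous_on_compose2[OF cont(3)]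
          continuous_on_compose2[OF cont(4)] continuous_on_compose2[OF cont(5)] continuous_intros)?)
      (use mem in auto)
  then have "compact ((\<lambda>(x, u, v). F x u v) ` ?K)"
    by (intro compact_continuous_image compact_Times compact_cball)
  then obtain M where M: "\<And>z. z \<in> (\<lambda>(x, u, v). F x u v) ` ?K \<Longrightarrow> norm z \<le> M"
    by (meson bounded_iff compact_imp_bounded)
  obtain r u where ru: "0 < r" "r \<le> R" "u holomorphic_on ball p r" "u p = q" "deriv u p = v0"
    "\<And>x. x \<in> ball p r \<Longrightarrow> u x \<in> ball q R"
    "\<And>x. x \<in> ball p r \<Longrightarrow> deriv (deriv u) x = F x (u x) (deriv u x)"
  proof (rule holomorphic_ode2_exists[OF R, of p q v0 F M])
    fix x u v assume "x \<in> ball p R" "u \<in> ball q R" "v \<in> ball v0 R"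
    then have "(x, u, v) \<in> ?K" by auto
    then show "norm (F x u v) \<le> M" by (intro M) force
  next
    fix S x u v
    assume S: "open S" and xuv: "x holomorphic_on S" "u holomorphic_on S" "v holomorphic_on S"
      and "\<And>t. t \<in> S \<Longrightarrow> x t \<in> ball p R \<and> u t \<in> ball q R \<and> v t \<in> ball v0 R"
    then have *: "(x t, u t) \<in> \<Omega> \<and> E (x t, u t) \<noteq> 0" if "t \<in> S" for t
      using that mem by (meson ball_subset_cball subsetD)
    then show "(\<lambda>t. F (x t) (u t) (v t)) holomorphic_on S"
      unfolding F_def
      using hol[THEN holomorphic2_on_compose, OF S xuv(1,2)] xuv(3)
      by (intro holomorphic_intros) auto
  qed (blast intro: that)
  have "integral_curve \<Omega> A B C D E (ball p r) u"
    unfolding integral_curve_def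
  proof (intro conjI ballI)
    fix x assume x: "x \<in> ball p r"
    then have xu: "x \<in> cball p R" "u x \<in> cball q R" using ru(2) ru(6)[OF x] by auto
    show "(x, u x) \<in> \<Omega>" using mem[OF xu] by blast
    show "E (x, u x) * deriv (deriv u) x =
          D (x, u x) * deriv u x ^ 3 + C (x, u x) * deriv u x ^ 2 + B (x, u x) * deriv u x + A (x, u x)"
      using mem[OF xu] ru(7)[OF x] by (simp add: F_def)
  qed (use ru in auto)
  then show thesis by (rule that) (use ru in auto)
qed

section \<open>The centre map and the cubic\<close>

text \<open>The centre lies on the normal, \<open>x0 = - v * y0\<close>, which recovers the slope;
  then \<open>w = (1 + v\<^sup>2) / y0\<close> recovers the second derivative. A non-isotropic slope
  ensures \<open>y0 \<noteq> 0\<close>.\<close>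

lemma curvature_centre_eq_iff:
  assumes "w \<noteq> 0" "1 + v\<^sup>2 \<noteq> 0"
  shows "curvature_centre v w = (x0, y0) \<longleftrightarrow>
    y0 \<noteq> 0 \<and> v = - x0 / y0 \<and> w = (x0\<^sup>2 + y0\<^sup>2) / y0 ^ 3"
proof
  assume "curvature_centre v w = (x0, y0)"
  then have x0: "x0 = - v * y0" and y0: "y0 = (1 + v\<^sup>2) / w"
    by (auto simp: curvature_centre_def)
  have y0_nz: "y0 \<noteq> 0" using assms y0 by simp
  have "w = (1 + v\<^sup>2) / y0" unfolding y0 using assms by (simp only: divide_divide_eq_right nonzero_mult_div_cancel_left not_False_eq_True)
  also have "\<dots> = (x0\<^sup>2 + y0\<^sup>2) / y0 ^ 3"
    using y0_nz by (simp add: x0 field_simps power2_eq_square power3_eq_cube)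
  finally show "y0 \<noteq> 0 \<and> v = - x0 / y0 \<and> w = (x0\<^sup>2 + y0\<^sup>2) / y0 ^ 3"
    using y0_nz x0 by simp
next
  assume *: "y0 \<noteq> 0 \<and> v = - x0 / y0 \<and> w = (x0\<^sup>2 + y0\<^sup>2) / y0 ^ 3"
  then have "1 + v\<^sup>2 = y0 * w"
    by (simp add: field_simps power2_eq_square power3_eq_cube)
  then show "curvature_centre v w = (x0, y0)"
    using * assms by (simp add: curvature_centre_def)
qed

text \<open>Multiply by \<open>y ^ 3\<close>. The odd powers of the slope \<open>- x / y\<close>
  produce the minus signs at \<open>d\<close> and \<open>b\<close>.\<close>

lemma projective_connection_iff_cubic:
  fixes x y a b c d e :: complex
  assumes "y \<noteq> 0"
  shows "e * ((x\<^sup>2 + y\<^sup>2) / y ^ 3) = d * (- x / y) ^ 3 + c * (- x / y)\<^sup>2 + b * (- x / y) + a \<longleftrightarrow>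
    e * (x\<^sup>2 + y\<^sup>2) = - d * x ^ 3 + c * x\<^sup>2 * y - b * x * y\<^sup>2 + a * y ^ 3"
proof -
  have "d * (- x / y) ^ 3 + c * (- x / y)\<^sup>2 + b * (- x / y) + a =
      (- d * x ^ 3 + c * x\<^sup>2 * y - b * x * y\<^sup>2 + a * y ^ 3) / y ^ 3"
    using assms by (simp add: field_simps power2_eq_square power3_eq_cube)
  then show ?thesis using assms by simp
qed

section \<open>Both inclusions between the locus and the cubic\<close>

theorem lemma3p5:
  fixes A B C D E :: "complex \<times> complex \<Rightarrow> complex"
    and \<Omega> :: "(complex \<times> complex) set"
    and p q :: complex
  assumes "open \<Omega>"
    and "A holomorphic2_on \<Omega>" and "B holomorphic2_on \<Omega>" and "C holomorphic2_on \<Omega>"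
    and "D holomorphic2_on \<Omega>" and "E holomorphic2_on \<Omega>"
    and "(p, q) \<in> \<Omega>" and "E (p, q) \<noteq> 0"
  shows "curvature_centre_locus \<Omega> A B C D E p q =
    {(x0, y0). y0 \<noteq> 0 \<and> x0\<^sup>2 + y0\<^sup>2 \<noteq> 0 \<and>
       E (p, q) * (x0\<^sup>2 + y0\<^sup>2) =
         - D (p, q) * x0 ^ 3 + C (p, q) * x0\<^sup>2 * y0 - B (p, q) * x0 * y0\<^sup>2 + A (p, q) * y0 ^ 3}"
proof (intro equalityI subsetI)
  fix z assume "z \<in> curvature_centre_locus \<Omega> A B C D E p q"
  then obtain U u where z: "z = curvature_centre (deriv u p) (deriv (deriv u) p)"
    and u: "integral_curve \<Omega> A B C D E U u" "p \<in> U" "u p = q"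
    and nz: "deriv (deriv u) p \<noteq> 0" "1 + (deriv u p)\<^sup>2 \<noteq> 0"
    unfolding curvature_centre_locus_def by blast
  obtain x0 y0 where xy: "z = (x0, y0)" by force
  from z xy curvature_centre_eq_iff[OF nz, of x0 y0]
  have *: "y0 \<noteq> 0" "deriv u p = - x0 / y0" "deriv (deriv u) p = (x0\<^sup>2 + y0\<^sup>2) / y0 ^ 3" by auto
  have "E (p, q) * deriv (deriv u) p = D (p, q) * deriv u p ^ 3 + C (p, q) * (deriv u p)\<^sup>2 +
      B (p, q) * deriv u p + A (p, q)"
    using u unfolding integral_curve_def by blast
  \<comment> \<open>The condition \<open>x0\<^sup>2 + y0\<^sup>2 \<noteq> 0\<close> comes from the
    nonzero second derivative.\<close>
  then show "z \<in> {(x0, y0). y0 \<noteq> 0 \<and> x0\<^sup>2 + y0\<^sup>2 \<noteq> 0 \<and>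
       E (p, q) * (x0\<^sup>2 + y0\<^sup>2) =
         - D (p, q) * x0 ^ 3 + C (p, q) * x0\<^sup>2 * y0 - B (p, q) * x0 * y0\<^sup>2 + A (p, q) * y0 ^ 3}"
    using * nz(1) projective_connection_iff_cubic[OF *(1)] unfolding xy *(2,3) by auto
next
  fix z assume "z \<in> {(x0, y0). y0 \<noteq> 0 \<and> x0\<^sup>2 + y0\<^sup>2 \<noteq> 0 \<and>
       E (p, q) * (x0\<^sup>2 + y0\<^sup>2) =
         - D (p, q) * x0 ^ 3 + C (p, q) * x0\<^sup>2 * y0 - B (p, q) * x0 * y0\<^sup>2 + A (p, q) * y0 ^ 3}"
  then obtain x0 y0 where z: "z = (x0, y0)" and nz: "y0 \<noteq> 0" "x0\<^sup>2 + y0\<^sup>2 \<noteq> 0"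
    and cubic: "E (p, q) * (x0\<^sup>2 + y0\<^sup>2) =
         - D (p, q) * x0 ^ 3 + C (p, q) * x0\<^sup>2 * y0 - B (p, q) * x0 * y0\<^sup>2 + A (p, q) * y0 ^ 3"
    by auto
  \<comment> \<open>Only the slope can be prescribed. The equation then determines the second
    derivative at \<open>p\<close>, as \<open>E (p, q) \<noteq> 0\<close>, and the cubic says that
    it has the value required by the inverse centre map.\<close>
  obtain U u where u: "integral_curve \<Omega> A B C D E U u" "p \<in> U" "u p = q" "deriv u p = - x0 / y0"
    using integral_curve_exists[OF assms] by blast
  have "E (p, q) * deriv (deriv u) p = D (p, q) * deriv u p ^ 3 + C (p, q) * (deriv u p)\<^sup>2 +
      B (p, q) * deriv u p + A (p, q)"
    using u unfolding integral_curve_def by blast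
  also have "\<dots> = E (p, q) * ((x0\<^sup>2 + y0\<^sup>2) / y0 ^ 3)"
    unfolding u(4) using cubic projective_connection_iff_cubic[OF nz(1)] by metis
  finally have w: "deriv (deriv u) p = (x0\<^sup>2 + y0\<^sup>2) / y0 ^ 3" 

    using assms(8) by (simp only: mult_cancel_left simp_thms)
  \<comment> \<open>Thus \<open>x0\<^sup>2 + y0\<^sup>2 \<noteq> 0\<close> rules out both an
    isotropic slope and an inflection.\<close>
  have "1 + (deriv u p)\<^sup>2 = (x0\<^sup>2 + y0\<^sup>2) / y0\<^sup>2"
    unfolding u(4) using nz(1) by (simp add: power_divide field_simps)
  with nz w have nz': "deriv (deriv u) p \<noteq> 0" "1 + (deriv u p)\<^sup>2 \<noteq> 0" by auto
  then have "curvature_centre (deriv u p) (deriv (deriv u) p) = z"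
    using curvature_centre_eq_iff[of "deriv (deriv u) p" "deriv u p" x0 y0] nz(1) u(4) w z by simp
  then show "z \<in> curvature_centre_locus \<Omega> A B C D E p q"
    unfolding curvature_centre_locus_def using u nz' by blast
qed

end
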